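(* Let $r\ge1$ and let $(X,\sigma_X,\varphi)$ be a shift-reversal system of finite type of order $2r$. Then there are zero-one square matrices $A$ and $J$ (of the same size, not depending on $m$ or $l$) such that $$f_{\sigma_X,\varphi}(m,2l)=\operatorname{tr}(A^mJ^{2l})\qquad\text{for all integers } m\ge 1 \text{ and } 0\le l<r.$$
   Context: A shift space is a closed shift-invariant subset $X$ of $\mathcal{A}^{\mathbb{Z}}$, where $\mathcal{A}$ is a finite set with the discrete topology and $\mathcal{A}^{\mathbb{Z}}$ has the product topology; $\sigma_X$ is the restriction to $X$ of the shift map $\sigma(x)_i=x_{i+1}$. A reversal for $(X,\sigma_X)$ is a homeomorphism $\varphi:X\to X$ with $\sigma_X\circ\varphi=\varphi\circ\sigma_X^{-1}$; the reversal system $(X,\sigma_X,\varphi)$ has order $2r$ if $2r$ is the least positive integer $n$ with $\varphi^n=\mathrm{id}_X$. It is called a shift-reversal system of finite type if $(X,\sigma_X)$ is a shift of finite type. For integers $m\ge1$ and $0\le l<r$, $$f_{\sigma_X,\varphi}(m,2l)=|\{x\in X: (\sigma_X)^m\circ\varphi^{2l}(x)=x\}|.$$ *)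

theory Defs
  imports "HOL-Analysis.Function_Topology" "Jordan_Normal_Form.Matrix"
begin

text \<open>The alphabet is a finite set \<open>\<A>\<close> of elements of a type \<open>'a\<close>; bi-infinite sequences are functions
  \<open>int \<Rightarrow> 'a\<close>. The topology of an arbitrary type \<open>'a\<close> plays no role: \<open>\<A>\<close> is made discrete explicitly.\<close>

definition shift :: "(int \<Rightarrow> 'a) \<Rightarrow> int \<Rightarrow> 'a" where
  "shift x = (\<lambda>i. x (i + 1))"

definition full_shift_topology :: "'a set \<Rightarrow> (int \<Rightarrow> 'a) topology" where
  "full_shift_topology \<A> = product_topology (\<lambda>_. discrete_topology \<A>) UNIV"

text \<open>Shift-invariance means \<open>\<sigma>(X) = X\<close>, so that the restriction of the shift to \<open>X\<close> is invertible.\<close>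

definition shift_space :: "'a set \<Rightarrow> (int \<Rightarrow> 'a) set \<Rightarrow> bool" where
  "shift_space \<A> X \<longleftrightarrow>
     finite \<A> \<and> closedin (full_shift_topology \<A>) X \<and> shift ` X = X"

definition occurs_in :: "'a list \<Rightarrow> (int \<Rightarrow> 'a) \<Rightarrow> bool" where
  "occurs_in w x \<longleftrightarrow> (\<exists>i. \<forall>k<length w. x (i + int k) = w ! k)"

definition finite_type :: "'a set \<Rightarrow> (int \<Rightarrow> 'a) set \<Rightarrow> bool" where
  "finite_type \<A> X \<longleftrightarrow>
     (\<exists>F. finite F \<and> F \<subseteq> lists \<A> \<and>
        X = {x. range x \<subseteq> \<A> \<and> (\<forall>w\<in>F. \<not> occurs_in w x)})"

definition reversal :: "'a set \<Rightarrow> (int \<Rightarrow> 'a) set \<Rightarrow> ((int \<Rightarrow> 'a) \<Rightarrow> (int \<Rightarrow> 'a)) \<Rightarrow> bool" where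
  "reversal \<A> X \<phi> \<longleftrightarrow>
     homeomorphic_map (subtopology (full_shift_topology \<A>) X)
       (subtopology (full_shift_topology \<A>) X) \<phi> \<and>
     (\<forall>x\<in>X. shift (\<phi> x) = \<phi> (inv_into X shift x))"

definition has_order :: "'b set \<Rightarrow> ('b \<Rightarrow> 'b) \<Rightarrow> nat \<Rightarrow> bool" where
  "has_order X \<phi> n \<longleftrightarrow>
     0 < n \<and> (\<forall>x\<in>X. (\<phi> ^^ n) x = x) \<and>
     (\<forall>k. 0 < k \<and> k < n \<longrightarrow> \<not> (\<forall>x\<in>X. (\<phi> ^^ k) x = x))"

definition shift_reversal_system_of_finite_type ::
    "'a set \<Rightarrow> (int \<Rightarrow> 'a) set \<Rightarrow> ((int \<Rightarrow> 'a) \<Rightarrow> (int \<Rightarrow> 'a)) \<Rightarrow> bool" where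
  "shift_reversal_system_of_finite_type \<A> X \<phi> \<longleftrightarrow>
     shift_space \<A> X \<and> finite_type \<A> X \<and> reversal \<A> X \<phi>"

definition fixed_points ::
    "(int \<Rightarrow> 'a) set \<Rightarrow> ((int \<Rightarrow> 'a) \<Rightarrow> (int \<Rightarrow> 'a)) \<Rightarrow> nat \<Rightarrow> nat \<Rightarrow> (int \<Rightarrow> 'a) set" where
  "fixed_points X \<phi> m k = {x \<in> X. (shift ^^ m) ((\<phi> ^^ k) x) = x}"

definition zero_one_square_mat :: "nat \<Rightarrow> int mat \<Rightarrow> bool" where
  "zero_one_square_mat n A \<longleftrightarrow> A \<in> carrier_mat n n \<and> elements_mat A \<subseteq> {0, 1}"

definition mat_tr :: "'a :: comm_monoid_add mat \<Rightarrow> 'a" where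
  "mat_tr A = (\<Sum>i<dim_row A. A $$ (i, i))"

end

theory Submission
  imports Defs
begin

text \<open>The state of a point \<open>x\<close> consists of the windows \<open>[-N, N]\<close> of all \<open>\<phi>\<^sup>j x\<close>. For \<open>N\<close> larger than the
  length of the forbidden words and the radius of the block codes of all \<open>\<phi>\<^sup>j\<close>, every bi-infinite walk
  on states is the state sequence of a unique point of \<open>X\<close>. Let \<open>A\<close> be the adjacency matrix of states
  and \<open>J\<close> the permutation matrix of the action of \<open>\<phi>\<close> on states: a point fixed by \<open>\<sigma>\<^sup>m \<phi>\<^sup>2\<^sup>l\<close> amounts to a
  walk of length \<open>m\<close> whose end is carried to its start by \<open>\<phi>\<^sup>2\<^sup>l\<close>, and the trace counts these walks.\<close>

section \<open>Walks and traces\<close>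

text \<open>Extensional functions, so that two walks are equal as soon as they agree at the times
  \<open>0\<close> to \<open>m\<close>, and a finite \<open>S\<close> has only finitely many walks
  of a given length.\<close>

definition walks :: "'s set \<Rightarrow> ('s \<Rightarrow> 's \<Rightarrow> bool) \<Rightarrow> nat \<Rightarrow> (nat \<Rightarrow> 's) set" where
  "walks S E m = {p \<in> {..m} \<rightarrow>\<^sub>E S. \<forall>t<m. E (p t) (p (Suc t))}"

lemma finite_walks: "finite S \<Longrightarrow> finite (walks S E m)"
  unfolding walks_def by (rule finite_subset[of _ "{..m} \<rightarrow>\<^sub>E S"]) (auto intro: finite_PiE)

lemma card_walks_from_to_0:
  assumes "u \<in> S"
  shows "card {p \<in> walks S E 0. p 0 = u \<and> p 0 = v} = of_bool (u = v)"
proof (cases "u = v")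
  case True
  have "{p \<in> walks S E 0. p 0 = u \<and> p 0 = v} = {\<lambda>t\<in>{..0}. u}"
    using True assms by (auto simp: walks_def PiE_def extensional_def restrict_def)
  with True show ?thesis by simp
next
  case False
  hence "{p \<in> walks S E 0. p 0 = u \<and> p 0 = v} = {}" by auto
  with False show ?thesis by (simp del: Collect_empty_eq)
qed

text \<open>Removing the final edge leaves a walk of length \<open>m\<close> that ends at the last
  vertex but one, here called \<open>w\<close>.\<close>

lemma walks_Suc_from_to:
  assumes "v \<in> S"
  shows "{p \<in> walks S E (Suc m). p 0 = u \<and> p (Suc m) = v} =
    (\<Union>w\<in>{w \<in> S. E w v}. (\<lambda>p. p(Suc m := v)) ` {p \<in> walks S E m. p 0 = u \<and> p m = w})"
    (is "?L = ?R")
proof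
  show "?L \<subseteq> ?R"
  proof
    fix p assume p: "p \<in> ?L"
    \<comment> \<open>Resetting the last time to \<open>undefined\<close> makes the shortened walk
      extensional on \<open>{..m}\<close>.\<close>
    let ?q = "p(Suc m := undefined)"
    have "?q \<in> {..m} \<rightarrow>\<^sub>E S"
      using p by (auto simp: walks_def PiE_def extensional_def)
    hence "?q \<in> walks S E m" using p by (auto simp: walks_def)
    moreover have "p = ?q(Suc m := v)" using p by auto
    moreover have "p m \<in> S" "E (p m) v" "p 0 = u" using p by (auto simp: walks_def)
    ultimately show "p \<in> ?R"
      by (intro UN_I[of "p m"]) (auto intro!: image_eqI[of _ _ ?q])
  qed
  show "?R \<subseteq> ?L"
    using assms by (auto simp: walks_def PiE_def extensional_def Pi_def less_Suc_eq)
qed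

text \<open>This is the recursion of matrix multiplication by the adjacency matrix. The pieces for
  different \<open>w\<close> are disjoint because appending \<open>v\<close> is injective.\<close>

lemma card_walks_from_to_Suc:
  assumes "finite S" "v \<in> S"
  shows "card {p \<in> walks S E (Suc m). p 0 = u \<and> p (Suc m) = v} =
    (\<Sum>w\<in>S. card {p \<in> walks S E m. p 0 = u \<and> p m = w} * of_bool (E w v))"
proof -
  let ?W = "\<lambda>w. {p \<in> walks S E m. p 0 = u \<and> p m = w}"
  let ?f = "\<lambda>p::nat \<Rightarrow> 'a. p(Suc m := v)"
  have inj: "inj_on ?f (walks S E m)"
  proof (rule inj_onI)
    fix p q assume pq: "p \<in> walks S E m" "q \<in> walks S E m" "?f p = ?f q"
    \<comment> \<open>Both values are \<open>undefined\<close>, so overwriting them with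
      \<open>v\<close> loses nothing.\<close>
    have "p (Suc m) = q (Suc m)"
      using pq(1,2) by (auto simp: walks_def PiE_def extensional_def)
    with pq(3) show "p = q" by (metis fun_upd_triv fun_upd_upd)
  qed
  have c: "card (?f ` ?W w) = card (?W w)" for w
    by (rule card_image, rule inj_on_subset[OF inj]) auto
  have "card {p \<in> walks S E (Suc m). p 0 = u \<and> p (Suc m) = v} =
      (\<Sum>w\<in>{w \<in> S. E w v}. card (?f ` ?W w))"
    unfolding walks_Suc_from_to[OF assms(2)]
  proof (rule card_UN_disjoint)
    show "finite {w \<in> S. E w v}" using assms by simp
    show "\<forall>w\<in>{w \<in> S. E w v}. finite (?f ` ?W w)"
      using finite_walks[OF assms(1)] by auto
    have "w = w'" if "p \<in> ?W w" "q \<in> ?W w'" "?f p = ?f q" for w w' p q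
    proof -
      have "p = q" using inj that by (auto dest: inj_onD)
      with that show ?thesis by simp
    qed
    thus "\<forall>w\<in>{w \<in> S. E w v}. \<forall>w'\<in>{w \<in> S. E w v}. w \<noteq> w' \<longrightarrow> ?f ` ?W w \<inter> ?f ` ?W w' = {}"
      by blast
  qed
  also have "\<dots> = (\<Sum>w\<in>{w \<in> S. E w v}. card (?W w))" by (simp only: c)
  also have "\<dots> = (\<Sum>w\<in>S. card (?W w) * of_bool (E w v))"
    using assms(1) by (intro sum.mono_neutral_cong_left) auto
  finally show ?thesis .
qed

text \<open>One encoding for both matrices: the adjacency matrix of a graph, and the matrix of a map
  \<open>\<pi>\<close> through the relation \<open>\<pi> u = v\<close>.\<close>

definition relation_mat :: "nat \<Rightarrow> (nat \<Rightarrow> 's) \<Rightarrow> ('s \<Rightarrow> 's \<Rightarrow> bool) \<Rightarrow> int mat" where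
  "relation_mat n e E = mat n n (\<lambda>(i, j). of_bool (E (e i) (e j)))"

lemma relation_mat_carrier [simp]: "relation_mat n e E \<in> carrier_mat n n"
  "dim_row (relation_mat n e E) = n"
  by (simp_all add: relation_mat_def)

lemma zero_one_relation_mat: "zero_one_square_mat n (relation_mat n e E)"
  by (auto simp: zero_one_square_mat_def elements_mat_def relation_mat_def)

section \<open>Entries of matrix powers and traces of products\<close>

lemma mult_square_mat_index:
  fixes A B :: "'b :: semiring_0 mat"
  assumes "A \<in> carrier_mat n n" "B \<in> carrier_mat n n" "i < n" "j < n"
  shows "(A * B) $$ (i, j) = (\<Sum>k<n. A $$ (i, k) * B $$ (k, j))"
  using assms by (auto simp: scalar_prod_def lessThan_atLeast0 intro!: sum.cong)

text \<open>Induction on the length of the walk. The column \<open>j\<close> stays arbitrary because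
  the last step changes the end vertex.\<close>

lemma relation_mat_pow_index:
  assumes "bij_betw e {..<n} S" "i < n" "j < n"
  shows "(relation_mat n e E ^\<^sub>m m) $$ (i, j) =
    int (card {p \<in> walks S E m. p 0 = e i \<and> p m = e j})"
  using assms(3)
proof (induction m arbitrary: j)
  case 0
  have "e i \<in> S" using assms by (auto simp: bij_betw_def)
  moreover have "e i = e j \<longleftrightarrow> i = j" using assms 0 by (auto simp: bij_betw_def inj_on_def)
  ultimately show ?case using 0 assms(2) card_walks_from_to_0[of "e i" S E "e j"]
    by (simp add: relation_mat_def)
next
  case (Suc m)
  let ?A = "relation_mat n e E"
  have fin: "finite S" using assms(1) bij_betw_finite by blast
  have "e j \<in> S" using assms Suc.prems by (auto simp: bij_betw_def)
  note step = card_walks_from_to_Suc[OF fin this, of E m "e i"]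
  have car: "?A ^\<^sub>m m \<in> carrier_mat n n" by (rule pow_carrier_mat) simp
  have "(?A ^\<^sub>m Suc m) $$ (i, j) = (\<Sum>k<n. (?A ^\<^sub>m m) $$ (i, k) * ?A $$ (k, j))"
    unfolding pow_mat.simps
    by (rule mult_square_mat_index[OF car relation_mat_carrier(1) assms(2) Suc.prems])
  also have "\<dots> = (\<Sum>k<n. int (card {p \<in> walks S E m. p 0 = e i \<and> p m = e k}) * of_bool (E (e k) (e j)))"
    using Suc by (intro sum.cong) (auto simp: relation_mat_def)
  also have "\<dots> = (\<Sum>w\<in>S. int (card {p \<in> walks S E m. p 0 = e i \<and> p m = w}) * of_bool (E w (e j)))"
    using sum.reindex_bij_betw[OF assms(1),
      of "\<lambda>w. int (card {p \<in> walks S E m. p 0 = e i \<and> p m = w}) * of_bool (E w (e j))"] .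
  also have "\<dots> = int (card {p \<in> walks S E (Suc m). p 0 = e i \<and> p (Suc m) = e j})"
    unfolding step by simp
  finally show ?case .
qed

text \<open>Since \<open>\<pi>\<close> maps \<open>S\<close> to itself, each row has exactly one
  entry \<open>1\<close>, so the sum in the matrix product collapses to a single term.\<close>

lemma function_mat_pow_index:
  assumes "bij_betw e {..<n} S" "\<pi> ` S \<subseteq> S" "i < n" "j < n"
  shows "(relation_mat n e (\<lambda>u v. \<pi> u = v) ^\<^sub>m k) $$ (i, j) = of_bool ((\<pi> ^^ k) (e i) = e j)"
  using assms(4)
proof (induction k arbitrary: j)
  case 0
  thus ?case using assms by (auto simp: relation_mat_def bij_betw_def inj_on_def)
next
  case (Suc k)
  let ?P = "relation_mat n e (\<lambda>u v. \<pi> u = v)"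
  have fin: "finite S" using assms(1) bij_betw_finite by blast
  have iS: "(\<pi> ^^ k) (e i) \<in> S"
    using assms by (induction k) (auto simp: bij_betw_def)
  have car: "?P ^\<^sub>m k \<in> carrier_mat n n" by (rule pow_carrier_mat) simp
  have "(?P ^\<^sub>m Suc k) $$ (i, j) = (\<Sum>h<n. (?P ^\<^sub>m k) $$ (i, h) * ?P $$ (h, j))"
    unfolding pow_mat.simps
    by (rule mult_square_mat_index[OF car relation_mat_carrier(1) assms(3) Suc.prems])
  also have "\<dots> = (\<Sum>h<n. of_bool ((\<pi> ^^ k) (e i) = e h) * of_bool (\<pi> (e h) = e j))"
    using Suc by (intro sum.cong) (auto simp: relation_mat_def)
  also have "\<dots> = (\<Sum>w\<in>S. of_bool ((\<pi> ^^ k) (e i) = w) * of_bool (\<pi> w = e j))"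
    using sum.reindex_bij_betw[OF assms(1),
      of "\<lambda>w. of_bool ((\<pi> ^^ k) (e i) = w) * (of_bool (\<pi> w = e j) :: int)"] .
  also have "\<dots> = (\<Sum>w\<in>S. if (\<pi> ^^ k) (e i) = w then of_bool (\<pi> w = e j) else 0)"
    by (intro sum.cong) auto
  also have "\<dots> = of_bool ((\<pi> ^^ Suc k) (e i) = e j)"
    using fin iS by (simp add: sum.delta)
  finally show ?case .
qed

text \<open>Entries of the first power count walks with given ends, and the transposed entry of the
  second tests whether \<open>\<pi> ^^ k\<close> carries the end back to the start. Each such walk
  is counted once, at its pair of ends.\<close>

lemma mat_tr_walks:
  assumes "bij_betw e {..<n} S" "\<pi> ` S \<subseteq> S"
  shows "mat_tr (relation_mat n e E ^\<^sub>m m * relation_mat n e (\<lambda>u v. \<pi> u = v) ^\<^sub>m k) =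
    int (card {p \<in> walks S E m. (\<pi> ^^ k) (p m) = p 0})"
proof -
  let ?A = "relation_mat n e E ^\<^sub>m m" and ?P = "relation_mat n e (\<lambda>u v. \<pi> u = v) ^\<^sub>m k"
  let ?W = "\<lambda>u v. {p \<in> walks S E m. p 0 = u \<and> p m = v}"
  have fin: "finite S" using assms(1) bij_betw_finite by blast
  have car: "?A \<in> carrier_mat n n" "?P \<in> carrier_mat n n" by (auto intro!: pow_carrier_mat)
  have "mat_tr (?A * ?P) = (\<Sum>i<n. \<Sum>j<n. ?A $$ (i, j) * ?P $$ (j, i))"
    unfolding mat_tr_def using car
    by (intro sum.cong) (auto simp: mult_square_mat_index[OF car] simp del: index_mult_mat(1))
  also have "\<dots> = (\<Sum>i<n. \<Sum>j<n. int (card (?W (e i) (e j))) * of_bool ((\<pi> ^^ k) (e j) = e i))"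
    using relation_mat_pow_index[OF assms(1)] function_mat_pow_index[OF assms]
    by (intro sum.cong) auto
  also have "\<dots> = (\<Sum>u\<in>S. \<Sum>v\<in>S. int (card (?W u v)) * of_bool ((\<pi> ^^ k) v = u))"
    using sum.reindex_bij_betw[OF assms(1),
      of "\<lambda>u. \<Sum>j<n. int (card (?W u (e j))) * of_bool ((\<pi> ^^ k) (e j) = u)"]
      sum.reindex_bij_betw[OF assms(1),
        of "\<lambda>v. int (card (?W u v)) * of_bool ((\<pi> ^^ k) v = u)" for u]
    by simp
  also have "\<dots> = int (\<Sum>(u, v)\<in>S \<times> S. card {p \<in> ?W u v. (\<pi> ^^ k) (p m) = p 0})"
  proof -
    have *: "card {p \<in> ?W u v. (\<pi> ^^ k) (p m) = p 0} = card (?W u v) * of_bool ((\<pi> ^^ k) v = u)"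
      for u v
    proof (cases "(\<pi> ^^ k) v = u")
      case True
      hence "{p \<in> ?W u v. (\<pi> ^^ k) (p m) = p 0} = ?W u v" by auto
      with True show ?thesis by simp
    next
      case False
      hence "{p \<in> ?W u v. (\<pi> ^^ k) (p m) = p 0} = {}" by auto
      with False show ?thesis by (simp del: Collect_empty_eq)
    qed
    show ?thesis unfolding * by (simp add: sum.cartesian_product split_def)
  qed
  also have "(\<Sum>(u, v)\<in>S \<times> S. card {p \<in> ?W u v. (\<pi> ^^ k) (p m) = p 0}) =
      card (\<Union>(u, v)\<in>S \<times> S. {p \<in> ?W u v. (\<pi> ^^ k) (p m) = p 0})"
    using fin finite_walks[OF fin]
    by (subst card_UN_disjoint) (auto simp: split_def)
  also have "(\<Union>(u, v)\<in>S \<times> S. {p \<in> ?W u v. (\<pi> ^^ k) (p m) = p 0}) =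
      {p \<in> walks S E m. (\<pi> ^^ k) (p m) = p 0}"
    by (auto simp: walks_def PiE_def Pi_def)
  finally show ?thesis .
qed

section \<open>Quasi-periodic sequences\<close>

text \<open>Moving by \<open>m\<close> applies \<open>f\<close>, so \<open>d * m\<close> is a true
  period. Reducing the block number \<open>i div m\<close> modulo \<open>d\<close> gives a natural
  exponent, also for negative \<open>i\<close>.\<close>

lemma quasi_periodic_eq:
  fixes u :: "int \<Rightarrow> 's"
  assumes per: "\<And>i. u (i + int m) = f (u i)" and fin: "\<And>i. (f ^^ d) (u i) = u i" and "d > 0"
  shows "u i = (f ^^ nat ((i div int m) mod int d)) (u (i mod int m))"
proof -
  have n: "u (i + int n * int m) = (f ^^ n) (u i)" for i n
  proof (induction n)
    case (Suc n)
    have "i + int (Suc n) * int m = i + int n * int m + int m" by (simp add: algebra_simps)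
    hence "u (i + int (Suc n) * int m) = u (i + int n * int m + int m)" by (rule arg_cong)
    thus ?case using Suc per[of "i + int n * int m"] by (simp only: funpow.simps comp_apply)
  qed simp
  have d: "u (i + int c * (int d * int m)) = u i" for i c
  proof (induction c)
    case (Suc c)
    have "i + int (Suc c) * (int d * int m) = (i + int c * (int d * int m)) + int d * int m"
      by (simp add: algebra_simps)
    hence "u (i + int (Suc c) * (int d * int m)) = u ((i + int c * (int d * int m)) + int d * int m)"
      by (rule arg_cong)
    also have "\<dots> = u (i + int c * (int d * int m))" unfolding n fin ..
    finally show ?case using Suc by simp
  qed simp
  have dz: "u (i + c * (int d * int m)) = u i" for i c
  proof (cases "c \<ge> 0")
    case True
    thus ?thesis using d[of i "nat c"] by simp
  next
    case False
    thus ?thesis using d[of "i + c * (int d * int m)" "nat (- c)"] by simp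
  qed
  \<comment> \<open>The block number \<open>q\<close> is its remainder modulo \<open>d\<close> plus
    a multiple of \<open>d\<close>; the multiple contributes whole periods
    \<open>d * m\<close>.\<close>
  define q where "q = i div int m"
  have nat: "int (nat (q mod int d)) = q mod int d" using \<open>d > 0\<close> by simp
  have "i = i mod int m + q * int m" by (simp add: q_def)
  also have "q * int m = (q mod int d) * int m + (q div int d) * (int d * int m)"
  proof -
    have "q = q mod int d + (q div int d) * int d" by simp
    hence "q * int m = (q mod int d + (q div int d) * int d) * int m" by (rule arg_cong)
    thus ?thesis by (simp only: distrib_right mult.assoc)
  qed
  finally have "i = (i mod int m + int (nat (q mod int d)) * int m) + (q div int d) * (int d * int m)"
    unfolding nat add.assoc .
  hence "u i = u ((i mod int m + int (nat (q mod int d)) * int m) + (q div int d) * (int d * int m))"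
    by (rule arg_cong)
  thus ?thesis by (simp only: dz n q_def)
qed

text \<open>Passing to the next block costs one application of \<open>f\<close>, even where the
  exponent wraps from \<open>d - 1\<close> to \<open>0\<close>, because \<open>f ^^ d\<close> fixes
  \<open>x\<close>.\<close>

lemma quasi_periodic_step:
  assumes "(f ^^ d) x = x" "d > 0"
  shows "(f ^^ nat ((q + 1) mod int d)) x = f ((f ^^ nat (q mod int d)) x)"
proof -
  have "(q + 1) mod int d = (q mod int d + 1) mod int d" by (rule mod_add_left_eq[symmetric])
  also have "\<dots> = int (Suc (nat (q mod int d)) mod d)"
    using assms(2) by (simp add: zmod_int add.commute)
  finally have "nat ((q + 1) mod int d) = Suc (nat (q mod int d)) mod d" by simp
  thus ?thesis using funpow_mod_eq[OF assms(1), of "Suc (nat (q mod int d))"] by simp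
qed

section \<open>Coding a reversal system of finite type\<close>

text \<open>The power of the shift with integer exponent \<open>i\<close>, so that forward and
  backward shifts are treated alike.\<close>

definition translate :: "int \<Rightarrow> (int \<Rightarrow> 'a) \<Rightarrow> int \<Rightarrow> 'a" where
  "translate i x = (\<lambda>k. x (i + k))"

lemma translate_0 [simp]: "translate 0 x = x"
  by (simp add: translate_def)

lemma translate_translate [simp]: "translate i (translate j x) = translate (i + j) x"
  by (auto simp: translate_def fun_eq_iff algebra_simps)

lemma shift_eq_translate: "shift = translate 1"
  by (auto simp: shift_def translate_def fun_eq_iff algebra_simps)

lemma shift_funpow: "(shift ^^ m) x = translate (int m) x"
  by (induction m) (simp_all add: shift_eq_translate algebra_simps)

text \<open>The combinatorial content of the hypotheses, with one radius \<open>N\<close> for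
  everything: \<open>memory\<close> expresses finite type, and \<open>block_code\<close> says that
  every power of \<open>\<phi>\<close> is a sliding block code of radius \<open>N\<close>.\<close>

locale reversal_coding =
  fixes \<A> :: "'a set" and X :: "(int \<Rightarrow> 'a) set" and \<phi> :: "(int \<Rightarrow> 'a) \<Rightarrow> (int \<Rightarrow> 'a)"
    and r :: nat and N :: int
  assumes fin_alphabet: "finite \<A>"
    and r_pos: "r \<ge> 1" and N_nonneg: "N \<ge> 0"
    and alphabet: "x \<in> X \<Longrightarrow> x i \<in> \<A>"
    and translate_in: "x \<in> X \<Longrightarrow> translate i x \<in> X"
    and phi_in: "x \<in> X \<Longrightarrow> \<phi> x \<in> X"
    and phi_translate: "x \<in> X \<Longrightarrow> \<phi> (translate i x) = translate (- i) (\<phi> x)"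
    and phi_order: "x \<in> X \<Longrightarrow> (\<phi> ^^ (2 * r)) x = x"
    and memory: "(\<And>i. \<exists>z\<in>X. \<forall>k. \<bar>k\<bar> \<le> N \<longrightarrow> y (i + k) = z k) \<Longrightarrow> y \<in> X"
    and block_code: "x \<in> X \<Longrightarrow> z \<in> X \<Longrightarrow> (\<And>k. \<bar>k\<bar> \<le> N \<Longrightarrow> x k = z k) \<Longrightarrow>
      (\<phi> ^^ j) x 0 = (\<phi> ^^ j) z 0"
begin

text \<open>A state records the central window of every \<open>\<phi>\<^sup>j x\<close>, so that \<open>\<phi>\<close> acts on states by
  advancing \<open>j\<close>. It takes finitely many values because \<open>\<phi>\<close> has finite order.\<close>

definition state :: "(int \<Rightarrow> 'a) \<Rightarrow> nat \<Rightarrow> int \<Rightarrow> 'a" where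
  "state x = (\<lambda>j k. if \<bar>k\<bar> \<le> N then (\<phi> ^^ j) x k else undefined)"

text \<open>A single point \<open>z\<close> witnesses the edge for all rows \<open>j\<close> at
  once. Hence row \<open>j\<close> moves by \<open>(- 1) ^ j\<close> along an edge: odd rows move
  backwards.\<close>

definition edge :: "(nat \<Rightarrow> int \<Rightarrow> 'a) \<Rightarrow> (nat \<Rightarrow> int \<Rightarrow> 'a) \<Rightarrow> bool" where
  "edge u v \<longleftrightarrow> (\<exists>z\<in>X. u = state z \<and> v = state (translate 1 z))"

definition advance :: "(nat \<Rightarrow> int \<Rightarrow> 'a) \<Rightarrow> nat \<Rightarrow> int \<Rightarrow> 'a" where
  "advance u = (\<lambda>j. u (Suc j))"

section \<open>The action of the reversal on points and states\<close>

lemma phi_pow_in: "x \<in> X \<Longrightarrow> (\<phi> ^^ j) x \<in> X"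
  by (induction j) (auto intro: phi_in)

lemma phi_pow_translate:
  "x \<in> X \<Longrightarrow> (\<phi> ^^ j) (translate i x) = translate ((- 1) ^ j * i) ((\<phi> ^^ j) x)"
  by (induction j) (auto simp: phi_translate phi_pow_in)

lemma phi_pow_mod: "x \<in> X \<Longrightarrow> (\<phi> ^^ (j mod (2 * r))) x = (\<phi> ^^ j) x"
  by (rule funpow_mod_eq[OF phi_order])

lemma advance_pow: "(advance ^^ a) u = (\<lambda>j. u (j + a))"
  by (induction a) (auto simp: advance_def fun_eq_iff)

lemma advance_pow_state: "(advance ^^ a) (state x) = state ((\<phi> ^^ a) x)"
  by (auto simp: advance_pow state_def fun_eq_iff funpow_add)

lemma advance_state: "advance (state x) = state (\<phi> x)"
  using advance_pow_state[of 1 x] by simp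

lemma advance_order: "u \<in> state ` X \<Longrightarrow> (advance ^^ (2 * r)) u = u"
  by (auto simp: advance_pow_state phi_order)

lemma advance_pow_in: "u \<in> state ` X \<Longrightarrow> (advance ^^ a) u \<in> state ` X"
  by (auto simp: advance_pow_state phi_pow_in)

text \<open>Since \<open>\<phi>\<close> reverses time, only its even powers preserve edges.\<close>

lemma edge_advance:
  assumes "edge u v" "even a"
  shows "edge ((advance ^^ a) u) ((advance ^^ a) v)"
proof -
  obtain z where z: "z \<in> X" "u = state z" "v = state (translate 1 z)"
    using assms by (auto simp: edge_def)
  thus ?thesis using assms(2)
    by (auto simp: edge_def advance_pow_state phi_pow_translate intro!: bexI[of _ "(\<phi> ^^ a) z"] phi_pow_in)
qed

lemma finite_states: "finite (state ` X)"
proof -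
  let ?D = "{..<2 * r} \<times> {- N..N}"
  \<comment> \<open>Rebuilds a state from its first \<open>2 * r\<close> rows, since the rows repeat
    with period \<open>2 * r\<close>.\<close>
  let ?g = "\<lambda>h j k. if \<bar>k\<bar> \<le> N then h (j mod (2 * r), k) else undefined"
  have "state ` X \<subseteq> ?g ` (?D \<rightarrow>\<^sub>E \<A>)"
  proof
    fix u assume "u \<in> state ` X"
    then obtain x where x: "x \<in> X" "u = state x" by auto
    let ?h = "\<lambda>(j, k)\<in>?D. (\<phi> ^^ j) x k"
    have "?h \<in> ?D \<rightarrow>\<^sub>E \<A>" using x alphabet phi_pow_in by auto
    moreover have "u = ?g ?h"
      using r_pos x by (auto simp: state_def fun_eq_iff phi_pow_mod abs_le_iff)
    ultimately show "u \<in> ?g ` (?D \<rightarrow>\<^sub>E \<A>)" by blast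
  qed
  moreover have "finite (?D \<rightarrow>\<^sub>E \<A>)" by (intro finite_PiE) (auto simp: fin_alphabet)
  ultimately show ?thesis by (meson finite_imageI finite_subset)
qed

text \<open>One edge slides row \<open>j\<close> by one place, in the direction
  \<open>(- 1) ^ j\<close>. Repeating this brings position \<open>k\<close> to the centre without
  leaving the window.\<close>

lemma edge_sequence_window:
  assumes "\<And>i. edge (u i) (u (i + 1))" "\<bar>k\<bar> \<le> N"
  shows "u i j k = u (i + (- 1) ^ j * k) j 0"
proof -
  have step: "u (i + 1) j k = u i j (k + (- 1) ^ j)"
    if "\<bar>k\<bar> \<le> N" "\<bar>k + (- 1) ^ j\<bar> \<le> N" for i k
  proof -
    obtain z where z: "z \<in> X" "u i = state z" "u (i + 1) = state (translate 1 z)"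
      using assms(1)[of i] by (auto simp: edge_def)
    have "(\<phi> ^^ j) (translate 1 z) k = (\<phi> ^^ j) z (k + (- 1) ^ j)"
      using z(1) by (simp add: phi_pow_translate) (simp add: translate_def add.commute)
    thus ?thesis using z that by (simp add: state_def)
  qed
  have pos: "u i j (int n) = u (i + (- 1) ^ j * int n) j 0" if "int n \<le> N" for n i
    using that
  proof (induction n arbitrary: i)
    case (Suc n)
    \<comment> \<open>For even \<open>j\<close> the edge leaving time \<open>i\<close> is used, for
      odd \<open>j\<close> the edge entering it. For negative positions the roles are
      exchanged.\<close>
    have "u i j (int (Suc n)) = u (i + (- 1) ^ j) j (int n)"
      using step[of "int n" i] step[of "int (Suc n)" "i - 1"] Suc.prems
      by (cases "even j") (auto simp: add.commute)
    thus ?case using Suc by (simp add: algebra_simps)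
  qed simp
  have neg: "u i j (- int n) = u (i + (- 1) ^ j * (- int n)) j 0" if "int n \<le> N" for n i
    using that
  proof (induction n arbitrary: i)
    case (Suc n)
    have "u i j (- int (Suc n)) = u (i - (- 1) ^ j) j (- int n)"
      using step[of "- int n" i] step[of "- int (Suc n)" "i - 1"] Suc.prems
      by (cases "even j") (auto simp: algebra_simps)
    thus ?case using Suc by (simp add: algebra_simps)
  qed simp
  show ?thesis
    using pos[of "nat k" i] neg[of "nat (- k)" i] assms(2) by (cases "k \<ge> 0") auto
qed

text \<open>The centres of row \<open>0\<close> spell out \<open>y\<close>. Around each time
  \<open>i\<close> it agrees with a point \<open>z\<close> of \<open>X\<close> whose state is
  \<open>u i\<close>, so \<open>memory\<close> puts \<open>y\<close> in \<open>X\<close> and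
  \<open>block_code\<close> makes the centres of all other rows agree.\<close>

lemma edge_sequence_realized:
  assumes e: "\<And>i. edge (u i) (u (i + 1))"
  obtains y where "y \<in> X" "\<And>i. state (translate i y) = u i"
proof -
  define y where "y = (\<lambda>i. u i 0 0)"
  have local: "\<exists>z\<in>X. u i = state z \<and> (\<forall>k. \<bar>k\<bar> \<le> N \<longrightarrow> y (i + k) = z k)" for i
  proof -
    obtain z where z: "z \<in> X" "u i = state z" using e[of i] by (auto simp: edge_def)
    have "y (i + k) = z k" if "\<bar>k\<bar> \<le> N" for k
      using edge_sequence_window[of u, OF e that, of i 0] z that by (simp add: y_def state_def)
    with z show ?thesis by blast
  qed
  have yX: "y \<in> X" by (rule memory) (use local in blast)
  have centre: "(\<phi> ^^ j) (translate i y) 0 = u i j 0" for i j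
  proof -
    obtain z where z: "z \<in> X" "u i = state z" "\<And>k. \<bar>k\<bar> \<le> N \<Longrightarrow> y (i + k) = z k"
      using local[of i] by blast
    have "(\<phi> ^^ j) (translate i y) 0 = (\<phi> ^^ j) z 0"
      by (rule block_code) (use z yX translate_in in \<open>auto simp: translate_def\<close>)
    thus ?thesis using z N_nonneg by (simp add: state_def)
  qed
  have "state (translate i y) j k = u i j k" for i j k
  proof (cases "\<bar>k\<bar> \<le> N")
    case True
    \<comment> \<open>An off-centre symbol of row \<open>j\<close> is the centre of that row at
      another time; the sign cancels because \<open>(- 1) ^ j\<close> squares to
      \<open>1\<close>.\<close>
    have "(\<phi> ^^ j) (translate i y) k = (\<phi> ^^ j) (translate (i + (- 1) ^ j * k) y) 0"
      by (simp add: phi_pow_translate[OF yX]) (simp add: translate_def algebra_simps flip: power_add mult_2)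
    thus ?thesis using True edge_sequence_window[of u, OF e True, of i j] by (simp add: centre state_def)
  next
    case False
    moreover obtain z where "u i = state z" using e[of i] by (auto simp: edge_def)
    ultimately show ?thesis by (simp add: state_def)
  qed
  thus ?thesis using that[OF yX] by blast
qed

lemma state_translate_inj:
  assumes "\<And>i. state (translate i x) = state (translate i y)"
  shows "x = y"
proof
  fix i
  have "state (translate i x) 0 0 = state (translate i y) 0 0" using assms by simp
  thus "x i = y i" using N_nonneg by (simp add: state_def translate_def)
qed

text \<open>For a point fixed by \<open>\<sigma>\<^sup>m \<phi>\<^sup>2\<^sup>l\<close> the sequence of states is quasi-periodic of period \<open>m\<close>
  with respect to \<open>advance\<close> raised to the power \<open>2 (r - l)\<close>, hence it is determined by one period.\<close>

lemma bij_betw_fixed_points_walks: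
  assumes "m \<ge> 1" "l < r"
  shows "bij_betw (\<lambda>x. \<lambda>t\<in>{..m}. state (translate (int t) x)) (fixed_points X \<phi> m (2 * l))
    {p \<in> walks (state ` X) edge m. (advance ^^ (2 * l)) (p m) = p 0}"
    (is "bij_betw ?\<Phi> ?F ?W")
proof -
  \<comment> \<open>On states \<open>f\<close> is the inverse of \<open>advance ^^ (2 * l)\<close>,
    because \<open>advance ^^ (2 * r)\<close> fixes every state. As an even power of
    \<open>advance\<close> it preserves edges.\<close>
  define f where "f = advance ^^ (2 * (r - l))"
  have f_pow: "f ^^ n = advance ^^ (2 * (r - l) * n)" for n
    by (simp add: f_def flip: funpow_mult)
  have inv: "f ((advance ^^ (2 * l)) u) = u" "(advance ^^ (2 * l)) (f u) = u" if "u \<in> state ` X" for u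
  proof -
    have "2 * (r - l) + 2 * l = 2 * r" "2 * l + 2 * (r - l) = 2 * r" using assms by simp_all
    thus "f ((advance ^^ (2 * l)) u) = u" "(advance ^^ (2 * l)) (f u) = u"
      using advance_order[OF that] by (metis comp_apply f_def funpow_add)+
  qed
  \<comment> \<open>\<open>f ^^ r\<close> is the power of \<open>advance\<close> with exponent
    \<open>2 * r * (r - l)\<close>, a multiple of \<open>2 * r\<close>.\<close>
  have f_order: "(f ^^ r) u = u" if "u \<in> state ` X" for u
  proof -
    have "(advance ^^ (2 * r * n)) u = u" for n
    proof (induction n)
      case (Suc n)
      have "2 * r * Suc n = 2 * r + 2 * r * n" by simp
      hence "(advance ^^ (2 * r * Suc n)) u = (advance ^^ (2 * r)) ((advance ^^ (2 * r * n)) u)"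
        by (simp only: funpow_add comp_apply)
      thus ?case using Suc advance_order[OF that] by simp
    qed simp
    from this[of "r - l"] show ?thesis by (simp add: f_pow mult_ac)
  qed
  have fixed: "x \<in> ?F \<longleftrightarrow> x \<in> X \<and> translate (int m) ((\<phi> ^^ (2 * l)) x) = x" for x
    by (simp add: fixed_points_def shift_funpow)
  have move: "translate i ((\<phi> ^^ (2 * l)) x) = (\<phi> ^^ (2 * l)) (translate i x)" if "x \<in> X" for x i
    using that by (simp add: phi_pow_translate)
  have twist: "(advance ^^ (2 * l)) (state (translate (i + int m) x)) = state (translate i x)"
    if "x \<in> ?F" for x i
  proof -
    have x: "x \<in> X" and fx: "translate (int m) ((\<phi> ^^ (2 * l)) x) = x"
      using that by (simp_all only: fixed)
    have "translate i x = (\<phi> ^^ (2 * l)) (translate (i + int m) x)"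
      using move[OF x, of "i + int m"] translate_translate[of i "int m" "(\<phi> ^^ (2 * l)) x"] fx
      by (simp only:)
    thus ?thesis by (simp only: advance_pow_state)
  qed
  have qper: "state (translate (i + int m) x) = f (state (translate i x))" if "x \<in> ?F" for x i
  proof -
    have "state (translate (i + int m) x) \<in> state ` X"
      using that translate_in by (auto simp: fixed)
    from inv(1)[OF this] show ?thesis using twist[OF that] by simp
  qed
  \<comment> \<open>The walk determines the states at all times, which gives injectivity.\<close>
  have formula: "state (translate i x) =
      (f ^^ nat ((i div int m) mod int r)) (?\<Phi> x (nat (i mod int m)))" if "x \<in> ?F" for x i
  proof -
    have "state (translate i x) =
        (f ^^ nat ((i div int m) mod int r)) (state (translate (i mod int m) x))"
      by (rule quasi_periodic_eq[where u = "\<lambda>i. state (translate i x)"])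
        (use that r_pos qper f_order translate_in in \<open>auto simp: fixed\<close>)
    moreover have "nat (i mod int m) \<le> m"
      using pos_mod_bound[of "int m" i] assms(1) unfolding nat_le_iff by linarith
    ultimately show ?thesis using assms by simp
  qed
  have "inj_on ?\<Phi> ?F"
  proof (rule inj_onI)
    fix x y assume x: "x \<in> ?F" and y: "y \<in> ?F" and eq: "?\<Phi> x = ?\<Phi> y"
    show "x = y"
    proof (rule state_translate_inj)
      fix i
      have "(f ^^ nat ((i div int m) mod int r)) (?\<Phi> x (nat (i mod int m))) =
          (f ^^ nat ((i div int m) mod int r)) (?\<Phi> y (nat (i mod int m)))"
        by (rule arg_cong[OF eq])
      from trans[OF trans[OF formula[OF x] this] formula[OF y, symmetric]]
      show "state (translate i x) = state (translate i y)" .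
    qed
  qed
  moreover have "?\<Phi> x \<in> ?W" if "x \<in> ?F" for x
  proof -
    have "edge (state (translate (int t) x)) (state (translate (int (Suc t)) x))" for t
      using that by (auto simp: edge_def fixed translate_in intro!: bexI[of _ "translate (int t) x"])
    thus ?thesis using that twist[OF that, of 0]
      by (auto simp: walks_def fixed translate_in)
  qed
  moreover have "p \<in> ?\<Phi> ` ?F" if p: "p \<in> ?W" for p
  proof -
    \<comment> \<open>The bi-infinite continuation of \<open>p\<close>: block number
      \<open>q\<close> is the image under \<open>f ^^ q\<close> of the first \<open>m\<close>
      states, with the exponent reduced modulo \<open>r\<close>.\<close>
    define u where "u = (\<lambda>i. (f ^^ nat ((i div int m) mod int r)) (p (nat (i mod int m))))"
    have pS: "p t \<in> state ` X" if "t \<le> m" for t using p that by (auto simp: walks_def)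
    have f_in: "(f ^^ n) v \<in> state ` X" if "v \<in> state ` X" for n v
      unfolding f_pow by (rule advance_pow_in[OF that])
    have mod_le: "nat (i mod int m) < m" for i
      using assms by (simp add: nat_less_iff)
    \<comment> \<open>The closing condition on \<open>p\<close>, solved for its end: the last state
      of the walk is the first state of the next block.\<close>
    have pm: "p m = f (p 0)"
      using p inv(1)[OF pS[of m]] by auto
    have u_per: "u (i + int m) = f (u i)" for i
      using quasi_periodic_step[OF f_order[OF pS], of "nat (i mod int m)" "i div int m"]
        assms mod_le[of i] r_pos by (simp add: u_def)
    have u_in: "u i \<in> state ` X" for i
      unfolding u_def using mod_le[of i] by (intro f_in pS) simp
    have div_mod: "(int s + int m * q) div int m = q" "(int s + int m * q) mod int m = int s"
      if "s < m" for s q using that by simp_all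
    have u_edge: "edge (u i) (u (i + 1))" for i
    proof -
      let ?q = "i div int m" and ?t = "nat (i mod int m)"
      have i: "i = int ?t + int m * ?q" using assms by simp
      have "edge (p ?t) (p (Suc ?t))" using p mod_le[of i] by (auto simp: walks_def)
      hence e: "edge (u i) ((f ^^ nat (?q mod int r)) (p (Suc ?t)))"
        unfolding u_def f_pow by (rule edge_advance) simp
      \<comment> \<open>Within a block this is the definition of \<open>u\<close>; at the end of a
        block \<open>pm\<close> joins it to the next one.\<close>
      have "(f ^^ nat (?q mod int r)) (p (Suc ?t)) = u (i + 1)"
      proof (cases "Suc ?t = m")
        case True
        have i1: "i + 1 = int m * (?q + 1)" 
        proof -
          have "int ?t + 1 = int m" by (subst True[symmetric]) simp
          with i show ?thesis by (simp only: distrib_left)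
        qed
        have "u (i + 1) = (f ^^ nat ((?q + 1) mod int r)) (p 0)"
          unfolding u_def i1 using assms by simp
        also have "\<dots> = f ((f ^^ nat (?q mod int r)) (p 0))"
          by (rule quasi_periodic_step) (use f_order pS r_pos in auto)
        also have "\<dots> = (f ^^ nat (?q mod int r)) (p m)" by (simp add: pm funpow_swap1)
        finally show ?thesis using True by simp
      next
        case False
        hence lt: "Suc ?t < m" using mod_le[of i] by simp
        have i1: "i + 1 = int (Suc ?t) + int m * ?q" using i by simp
        have "(i + 1) div int m = ?q" "(i + 1) mod int m = int (Suc ?t)"
          unfolding i1 by (rule div_mod[OF lt])+
        thus ?thesis by (simp only: u_def nat_int)
      qed
      with e show ?thesis by simp
    qed
    obtain y where y: "y \<in> X" "\<And>i. state (translate i y) = u i"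
      using edge_sequence_realized[of u] u_edge by blast
    \<comment> \<open>Both points have the state sequence \<open>u\<close>: moving by
      \<open>m\<close> applies \<open>f\<close>, which \<open>advance ^^ (2 * l)\<close>
      undoes.\<close>
    have "translate (int m) ((\<phi> ^^ (2 * l)) y) = y"
    proof (rule state_translate_inj)
      fix i
      have "state (translate i (translate (int m) ((\<phi> ^^ (2 * l)) y))) =
          (advance ^^ (2 * l)) (u (i + int m))"
        by (simp only: translate_translate move[OF y(1), of "i + int m"] advance_pow_state flip: y(2))
      also have "\<dots> = u i" using inv(2)[OF u_in] by (simp add: u_per)
      finally show "state (translate i (translate (int m) ((\<phi> ^^ (2 * l)) y))) = state (translate i y)"
        by (simp add: y)
    qed
    hence "y \<in> ?F" using y by (simp add: fixed)
    moreover have "p = ?\<Phi> y"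
    proof
      fix t
      consider "t < m" | "t = m" | "t > m" by linarith
      thus "p t = ?\<Phi> y t"
      proof cases
        case 1 thus ?thesis by (simp add: y u_def)
      next
        \<comment> \<open>Time \<open>m\<close> already belongs to the next block, where
          \<open>u\<close> takes the value \<open>f (p 0)\<close>.\<close>
        case 2 thus ?thesis using u_per[of 0] assms by (simp add: y pm) (simp add: u_def)
      next
        case 3 thus ?thesis using p by (auto simp: walks_def PiE_def extensional_def)
      qed
    qed
    ultimately show ?thesis by blast
  qed
  ultimately show ?thesis unfolding bij_betw_def by blast
qed

text \<open>The common size is the number of states, which depends on neither \<open>m\<close> nor
  \<open>l\<close> and is positive because \<open>X\<close> is nonempty.\<close>

lemma fixed_points_eq_mat_tr:
  assumes "X \<noteq> {}"
  shows "\<exists>n>0. \<exists>A J. zero_one_square_mat n A \<and> zero_one_square_mat n J \<and>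
           (\<forall>m l. 1 \<le> m \<and> l < r \<longrightarrow>
              finite (fixed_points X \<phi> m (2 * l)) \<and>
              int (card (fixed_points X \<phi> m (2 * l))) = mat_tr (A ^\<^sub>m m * J ^\<^sub>m (2 * l)))"
proof -
  obtain e where e: "bij_betw e {..<card (state ` X)} (state ` X)"
    using ex_bij_betw_nat_finite[OF finite_states] by (auto simp: lessThan_atLeast0)
  let ?n = "card (state ` X)"
  let ?A = "relation_mat ?n e edge" and ?J = "relation_mat ?n e (\<lambda>u v. advance u = v)"
  have adv: "advance ` state ` X \<subseteq> state ` X" by (auto simp: advance_state phi_in)
  have "finite (fixed_points X \<phi> m (2 * l)) \<and>
      int (card (fixed_points X \<phi> m (2 * l))) = mat_tr (?A ^\<^sub>m m * ?J ^\<^sub>m (2 * l))"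
    if "1 \<le> m" "l < r" for m l
    using bij_betw_fixed_points_walks[OF that] finite_walks[OF finite_states, of edge m]
    by (auto simp: mat_tr_walks[OF e adv] dest: bij_betw_same_card bij_betw_finite)
  moreover have "?n > 0" using assms finite_states by (simp add: card_gt_0_iff)
  ultimately show ?thesis using zero_one_relation_mat by blast
qed

end

section \<open>Sliding block codes\<close>

lemma topspace_full_shift: "topspace (full_shift_topology \<A>) = {x. range x \<subseteq> \<A>}"
  by (auto simp: full_shift_topology_def)

lemma openin_full_shift_window:
  assumes "openin (full_shift_topology \<A>) U" "x \<in> U"
  shows "\<exists>N::nat. \<forall>z\<in>topspace (full_shift_topology \<A>). (\<forall>k. \<bar>k\<bar> \<le> int N \<longrightarrow> z k = x k) \<longrightarrow> z \<in> U"
proof -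
  obtain V where V: "finite {i. V i \<noteq> \<A>}" "x \<in> Pi\<^sub>E UNIV V" "Pi\<^sub>E UNIV V \<subseteq> U"
    using assms unfolding full_shift_topology_def openin_product_topology_alt by fastforce
  \<comment> \<open>A basic open set restricts finitely many coordinates; the sum of their absolute
    values bounds each of them.\<close>
  let ?N = "\<Sum>i\<in>{i. V i \<noteq> \<A>}. nat \<bar>i\<bar>"
  have "z \<in> U" if z: "range z \<subseteq> \<A>" "\<And>k. \<bar>k\<bar> \<le> int ?N \<Longrightarrow> z k = x k" for z
  proof -
    have "z i \<in> V i" for i
    proof (cases "V i = \<A>")
      case True thus ?thesis using z by auto
    next
      case False
      hence "nat \<bar>i\<bar> \<le> ?N" using V(1) by (intro member_le_sum) auto
      hence "z i = x i" by (intro z(2)) linarith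
      thus ?thesis using V(2) by auto
    qed
    thus ?thesis using V(3) by auto
  qed
  thus ?thesis unfolding topspace_full_shift by blast
qed

lemma openin_cylinder:
  assumes "range x \<subseteq> \<A>"
  shows "openin (full_shift_topology \<A>) {z. range z \<subseteq> \<A> \<and> (\<forall>k. \<bar>k\<bar> \<le> int N \<longrightarrow> z k = x k)}"
proof -
  let ?V = "\<lambda>k. if \<bar>k\<bar> \<le> int N then {x k} else \<A>"
  have "finite {k. ?V k \<noteq> \<A>}"
    by (rule finite_subset[of _ "{- int N..int N}"]) auto
  hence "openin (full_shift_topology \<A>) (Pi\<^sub>E UNIV ?V)"
    using assms unfolding full_shift_topology_def openin_PiE_gen by auto
  also have "Pi\<^sub>E UNIV ?V = {z. range z \<subseteq> \<A> \<and> (\<forall>k. \<bar>k\<bar> \<le> int N \<longrightarrow> z k = x k)}"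
    using assms by (auto simp: PiE_def Pi_def split: if_splits)
  finally show ?thesis .
qed

lemma shift_space_compactin: "shift_space \<A> X \<Longrightarrow> compactin (full_shift_topology \<A>) X"
  unfolding shift_space_def full_shift_topology_def
  by (intro closedin_compact_space) (auto simp: compact_space_product_topology compact_space_discrete_topology)

text \<open>Finitely many of the cylinders given by \<open>loc\<close> cover \<open>X\<close>, and
  the sum of their radii works everywhere: a point agreeing with \<open>x\<close> on so large a
  window lies in the same cylinder as \<open>x\<close>.\<close>

lemma locally_constant_uniform:
  fixes h :: "(int \<Rightarrow> 'a) \<Rightarrow> 'b"
  assumes X: "compactin (full_shift_topology \<A>) X"
    and loc: "\<And>x. x \<in> X \<Longrightarrow> \<exists>N::nat. \<forall>z\<in>X. (\<forall>k. \<bar>k\<bar> \<le> int N \<longrightarrow> z k = x k) \<longrightarrow> h z = h x"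
  shows "\<exists>N::nat. \<forall>x\<in>X. \<forall>z\<in>X. (\<forall>k. \<bar>k\<bar> \<le> int N \<longrightarrow> z k = x k) \<longrightarrow> h z = h x"
proof -
  obtain R :: "(int \<Rightarrow> 'a) \<Rightarrow> nat"
    where R: "\<And>x z. \<lbrakk>x \<in> X; z \<in> X; \<forall>k. \<bar>k\<bar> \<le> int (R x) \<longrightarrow> z k = x k\<rbrakk> \<Longrightarrow> h z = h x"
    using loc by metis
  let ?C = "\<lambda>x. {z. range z \<subseteq> \<A> \<and> (\<forall>k. \<bar>k\<bar> \<le> int (R x) \<longrightarrow> z k = x k)}"
  have X_alph: "range x \<subseteq> \<A>" if "x \<in> X" for x
    using compactin_subset_topspace[OF X] that by (auto simp: topspace_full_shift)
  have "\<exists>\<F>. finite \<F> \<and> \<F> \<subseteq> ?C ` X \<and> X \<subseteq> \<Union>\<F>"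
    by (rule compactinD[OF X]) (use X_alph in \<open>auto intro!: openin_cylinder\<close>)
  then obtain Y where Y: "finite Y" "Y \<subseteq> X" "X \<subseteq> (\<Union>y\<in>Y. ?C y)"
    by (metis (no_types, lifting) finite_subset_image)
  have "h z = h x" if xz: "x \<in> X" "z \<in> X" "\<And>k. \<bar>k\<bar> \<le> int (sum R Y) \<Longrightarrow> z k = x k" for x z
  proof -
    obtain y where y: "y \<in> Y" "x \<in> ?C y" using Y xz(1) by blast
    have "R y \<le> sum R Y" using Y(1) y(1) by (intro member_le_sum) auto
    hence "\<bar>k\<bar> \<le> int (sum R Y)" if "\<bar>k\<bar> \<le> int (R y)" for k using that by linarith
    hence "h z = h y" using xz y Y(2) by (intro R) (auto simp del: of_nat_sum)
    moreover have "h x = h y" using xz y Y(2) by (intro R) auto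
    ultimately show ?thesis by simp
  qed
  thus ?thesis by blast
qed

text \<open>The Curtis-Hedlund-Lyndon argument: singletons of the discrete alphabet are open, so the
  symbol \<open>g x 0\<close> is locally constant in \<open>x\<close>, and compactness makes the
  radius uniform.\<close>

lemma continuous_block_code:
  assumes X: "compactin (full_shift_topology \<A>) X"
    and g: "continuous_map (subtopology (full_shift_topology \<A>) X)
      (subtopology (full_shift_topology \<A>) X) g"
  shows "\<exists>N::nat. \<forall>x\<in>X. \<forall>z\<in>X. (\<forall>k. \<bar>k\<bar> \<le> int N \<longrightarrow> z k = x k) \<longrightarrow> g z 0 = g x 0"
proof (rule locally_constant_uniform[OF X])
  fix x assume x: "x \<in> X"
  let ?T = "full_shift_topology \<A>"
  have sub: "X \<subseteq> topspace ?T" by (rule compactin_subset_topspace[OF X])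
  have "continuous_map ?T (discrete_topology \<A>) (\<lambda>x. x 0)"
    unfolding full_shift_topology_def by (rule continuous_map_product_projection) simp
  hence "continuous_map (subtopology ?T X) (discrete_topology \<A>) ((\<lambda>x. x 0) \<circ> g)"
    by (intro continuous_map_compose[OF g] continuous_map_from_subtopology)
  moreover have "g x \<in> X"
    using continuous_map_funspace[OF g] x sub by (auto simp: Pi_def)
  hence "g x 0 \<in> \<A>" using sub by (auto simp: topspace_full_shift)
  ultimately have "openin (subtopology ?T X) {z \<in> topspace (subtopology ?T X). g z 0 \<in> {g x 0}}"
    using openin_continuous_map_preimage[of "subtopology ?T X" "discrete_topology \<A>" "(\<lambda>x. x 0) \<circ> g" "{g x 0}"]
    by simp
  then obtain U where U: "openin ?T U" "{z \<in> topspace (subtopology ?T X). g z 0 \<in> {g x 0}} = U \<inter> X"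
    unfolding openin_subtopology by blast
  have "x \<in> U" using U(2) x sub by auto
  then obtain N :: nat where "\<forall>z\<in>topspace ?T. (\<forall>k. \<bar>k\<bar> \<le> int N \<longrightarrow> z k = x k) \<longrightarrow> z \<in> U"
    using openin_full_shift_window[OF U(1)] by blast
  with U(2) sub show "\<exists>N::nat. \<forall>z\<in>X. (\<forall>k. \<bar>k\<bar> \<le> int N \<longrightarrow> z k = x k) \<longrightarrow> g z 0 = g x 0"
    by blast
qed

lemma continuous_map_funpow:
  "continuous_map T T g \<Longrightarrow> continuous_map T T (g ^^ j)"
  by (induction j) (auto intro: continuous_map_compose)

section \<open>The trace formula\<close>

lemma translate_invariant:
  assumes "shift ` X = X"
  shows "x \<in> X \<Longrightarrow> translate i x \<in> X"
proof (induction i arbitrary: x rule: int_induct[where k = 0])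
  case base
  thus ?case by simp
next
  case (step1 i)
  have "translate 1 (translate i x) \<in> X"
    using assms step1 unfolding shift_eq_translate by blast
  thus ?case by (simp add: add.commute)
next
  case (step2 i)
  \<comment> \<open>Backward translations use that the shift maps \<open>X\<close> onto
    \<open>X\<close>.\<close>
  obtain y where y: "y \<in> X" "x = translate 1 y"
    using assms step2.prems by (auto simp: shift_eq_translate)
  thus ?case using step2.IH[OF y(1)] by simp
qed

text \<open>The reversal identity at the point \<open>translate 1 x\<close> is the case
  \<open>i = 1\<close>; induction in both directions gives the rest.\<close>

lemma reversal_translate:
  assumes X: "shift ` X = X" and maps: "\<And>x. x \<in> X \<Longrightarrow> \<phi> x \<in> X"
    and rev: "\<And>x. x \<in> X \<Longrightarrow> shift (\<phi> x) = \<phi> (inv_into X shift x)"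
  shows "x \<in> X \<Longrightarrow> \<phi> (translate i x) = translate (- i) (\<phi> x)"
proof -
  have inj: "inj_on shift X"
  proof (rule inj_onI)
    fix x y assume "shift x = shift y"
    hence "translate (- 1) (translate 1 x) = translate (- 1) (translate 1 y)"
      by (simp only: shift_eq_translate)
    thus "x = y" by simp
  qed
  have one: "\<phi> (translate 1 x) = translate (- 1) (\<phi> x)" if "x \<in> X" for x
  proof -
    have "translate 1 x \<in> X" by (rule translate_invariant[OF X that])
    from rev[OF this] have "translate 1 (\<phi> (translate 1 x)) = \<phi> x"
      using inv_into_f_f[OF inj that] by (simp add: shift_eq_translate)
    hence "translate (- 1) (translate 1 (\<phi> (translate 1 x))) = translate (- 1) (\<phi> x)" by simp
    thus ?thesis by simp
  qed
  show "x \<in> X \<Longrightarrow> \<phi> (translate i x) = translate (- i) (\<phi> x)"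
  proof (induction i arbitrary: x rule: int_induct[where k = 0])
    case base
    thus ?case by simp
  next
    case (step1 i)
    thus ?case using one[OF translate_invariant[OF X step1.prems, of i]]
      by (simp add: algebra_simps)
  next
    case (step2 i)
    have "\<phi> (translate i x) = translate (- 1) (\<phi> (translate (i - 1) x))"
      using one[OF translate_invariant[OF X step2.prems, of "i - 1"]] by simp
    hence "translate 1 (\<phi> (translate i x)) = \<phi> (translate (i - 1) x)" by simp
    thus ?case using step2 by (simp add: algebra_simps)
  qed
qed

text \<open>The sum of the lengths of the forbidden words exceeds no window: an occurrence starting
  at \<open>i\<close> fits into the window around \<open>i\<close>, hence would occur in a point of
  \<open>X\<close>.\<close>

lemma finite_type_memory:
  assumes "finite_type \<A> X"
  shows "\<exists>M::nat. \<forall>y. (\<forall>i. \<exists>z\<in>X. \<forall>k. \<bar>k\<bar> \<le> int M \<longrightarrow> y (i + k) = z k) \<longrightarrow> y \<in> X"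
proof -
  obtain F where F: "finite F" "X = {x. range x \<subseteq> \<A> \<and> (\<forall>w\<in>F. \<not> occurs_in w x)}"
    using assms by (auto simp: finite_type_def)
  have "y \<in> X" if y: "\<And>i. \<exists>z\<in>X. \<forall>k. \<bar>k\<bar> \<le> int (\<Sum>w\<in>F. length w) \<longrightarrow> y (i + k) = z k" for y
  proof -
    have "y i \<in> \<A>" for i
    proof -
      obtain z where "z \<in> X" "\<forall>k. \<bar>k\<bar> \<le> int (\<Sum>w\<in>F. length w) \<longrightarrow> y (i + k) = z k" using y[of i] by blast
      moreover from this have "y (i + 0) = z 0" by (metis abs_zero of_nat_0_le_iff)
      ultimately show ?thesis using F(2) by auto
    qed
    moreover have "\<not> occurs_in w y" if w: "w \<in> F" for w
    proof
      assume "occurs_in w y"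
      then obtain i where i: "\<And>k. k < length w \<Longrightarrow> y (i + int k) = w ! k"
        by (auto simp: occurs_in_def)
      obtain z where z: "z \<in> X" "\<And>k. \<bar>k\<bar> \<le> int (\<Sum>w\<in>F. length w) \<Longrightarrow> y (i + k) = z k"
        using y[of i] by blast
      have "length w \<le> (\<Sum>w\<in>F. length w)" using F(1) w by (intro member_le_sum) auto
      hence "z (0 + int k) = w ! k" if "k < length w" for k
        using i[OF that] z(2)[of "int k"] that by (simp del: of_nat_sum)
      hence "occurs_in w z" unfolding occurs_in_def by blast
      thus False using z(1) w F(2) by auto
    qed
    ultimately show ?thesis using F(2) by auto
  qed
  thus ?thesis by blast
qed

theorem theoremB:
  fixes \<A> :: "'a set" and X :: "(int \<Rightarrow> 'a) set"
    and \<phi> :: "(int \<Rightarrow> 'a) \<Rightarrow> (int \<Rightarrow> 'a)" and r :: nat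
  assumes "r \<ge> 1"
    and "shift_reversal_system_of_finite_type \<A> X \<phi>"
    and "has_order X \<phi> (2 * r)"
  shows "\<exists>n>0. \<exists>A J. zero_one_square_mat n A \<and> zero_one_square_mat n J \<and>
           (\<forall>m l. 1 \<le> m \<and> l < r \<longrightarrow>
              finite (fixed_points X \<phi> m (2 * l)) \<and>
              int (card (fixed_points X \<phi> m (2 * l))) = mat_tr (A ^\<^sub>m m * J ^\<^sub>m (2 * l)))"
proof -
  let ?T = "full_shift_topology \<A>"
  have sp: "shift_space \<A> X" and ft: "finite_type \<A> X" and rev: "reversal \<A> X \<phi>"
    using assms(2) by (auto simp: shift_reversal_system_of_finite_type_def)
  have comp: "compactin ?T X" by (rule shift_space_compactin[OF sp])
  have sub: "X \<subseteq> topspace ?T" by (rule compactin_subset_topspace[OF comp])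
  have inv: "shift ` X = X" using sp by (simp add: shift_space_def)
  have cont: "continuous_map (subtopology ?T X) (subtopology ?T X) \<phi>"
    using rev by (auto simp: reversal_def homeomorphic_imp_continuous_map)
  have maps: "\<phi> x \<in> X" if "x \<in> X" for x
    using continuous_map_funspace[OF cont] that sub by (auto simp: Pi_def)
  have ord: "(\<phi> ^^ (2 * r)) x = x" if "x \<in> X" for x
    using assms(3) that by (auto simp: has_order_def)
  have "\<exists>N::nat. \<forall>x\<in>X. \<forall>z\<in>X. (\<forall>k. \<bar>k\<bar> \<le> int N \<longrightarrow> z k = x k) \<longrightarrow> (\<phi> ^^ j) z 0 = (\<phi> ^^ j) x 0" for j
    by (rule continuous_block_code[OF comp continuous_map_funpow[OF cont]])
  then obtain R :: "nat \<Rightarrow> nat" where R: "\<And>j x z. \<lbrakk>x \<in> X; z \<in> X; \<forall>k. \<bar>k\<bar> \<le> int (R j) \<longrightarrow> z k = x k\<rbrakk>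
      \<Longrightarrow> (\<phi> ^^ j) z 0 = (\<phi> ^^ j) x 0"
    by metis
  obtain M :: nat
    where M: "\<And>y. (\<And>i. \<exists>z\<in>X. \<forall>k. \<bar>k\<bar> \<le> int M \<longrightarrow> y (i + k) = z k) \<Longrightarrow> y \<in> X"
    using finite_type_memory[OF ft] by blast
  \<comment> \<open>Large enough for \<open>memory\<close> and for the block codes of all powers
    below \<open>2 * r\<close>; higher powers of \<open>\<phi>\<close> reduce to these.\<close>
  define N where "N = int (M + sum R {..<2 * r})"
  have "reversal_coding \<A> X \<phi> r N"
  proof
    show "finite \<A>" using sp by (simp add: shift_space_def)
    show "x i \<in> \<A>" if "x \<in> X" for x i using sub that by (auto simp: topspace_full_shift)
    show "1 \<le> r" by fact
    show "0 \<le> N" unfolding N_def by (rule of_nat_0_le_iff)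
    show "\<phi> x \<in> X" "(\<phi> ^^ (2 * r)) x = x" "translate i x \<in> X" if "x \<in> X" for x i
      using maps ord translate_invariant[OF inv] that by blast+
    show "\<phi> (translate i x) = translate (- i) (\<phi> x)" if "x \<in> X" for x i
      by (rule reversal_translate[OF inv maps _ that]) (use rev in \<open>auto simp: reversal_def\<close>)
    show "y \<in> X" if y: "\<And>i. \<exists>z\<in>X. \<forall>k. \<bar>k\<bar> \<le> N \<longrightarrow> y (i + k) = z k" for y
    proof (rule M)
      fix i
      have "\<bar>k\<bar> \<le> N" if "\<bar>k\<bar> \<le> int M" for k using that unfolding N_def by linarith
      with y[of i] show "\<exists>z\<in>X. \<forall>k. \<bar>k\<bar> \<le> int M \<longrightarrow> y (i + k) = z k" by blast
    qed
    show "(\<phi> ^^ j) x 0 = (\<phi> ^^ j) z 0"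
      if "x \<in> X" "z \<in> X" and eq: "\<And>k. \<bar>k\<bar> \<le> N \<Longrightarrow> x k = z k" for x z j
    proof -
      let ?j = "j mod (2 * r)"
      have "R ?j \<le> sum R {..<2 * r}" using assms(1) by (intro member_le_sum) auto
      hence "\<bar>k\<bar> \<le> N" if "\<bar>k\<bar> \<le> int (R ?j)" for k using that unfolding N_def by linarith
      hence "(\<phi> ^^ ?j) x 0 = (\<phi> ^^ ?j) z 0" using that by (intro R) auto
      thus ?thesis using funpow_mod_eq[OF ord] that by metis
    qed
  qed
  \<comment> \<open>On the empty set \<open>\<phi>\<close> would already have order
    \<open>1\<close>, which is less than \<open>2 * r\<close>.\<close>
  moreover have "X \<noteq> {}"
  proof
    assume "X = {}"
    moreover have "\<not> (\<forall>x\<in>X. (\<phi> ^^ 1) x = x)"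
      using assms(1) assms(3)[unfolded has_order_def, THEN conjunct2, THEN conjunct2, THEN spec, of 1]
      by simp
    ultimately show False by simp
  qed
  ultimately show ?thesis by (rule reversal_coding.fixed_points_eq_mat_tr)
qed

end
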